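(* Let $\mathcal{T}$ be a repetitive tiling of $\mathbb{R}^d$ of finite local complexity and of finite tile type, with a set of proto-tiles $\mathcal{A}$. Let $A$ be a subgroup of the group of all topological eigenvalues for the topological dynamical system $(X_{\mathcal{T}},\mathbb{R}^d)$, and assume $0\in\overline{A\setminus\{0\}}$. Then for any $R_0>0$ and $\varepsilon>0$ there exist $R>0$, $a\in A\setminus\{0\}$ and a map $x\colon\bigcup_{L>R}\Pi_{\mathcal{T},L,\mathcal{A}}\to\mathbb{R}^d$ satisfying the following two conditions: (1) for any $\mathcal{P}_1,\mathcal{P}_2\in\bigcup_{L>R}\Pi_{\mathcal{T},L,\mathcal{A}}$, any $y\in\operatorname{Ker}\chi_a$ and any $z\in B(0,R_0)$, the set of tiles $$(\mathcal{P}_1+x(\mathcal{P}_1))\cup\Bigl(\mathcal{P}_2+x(\mathcal{P}_2)+\tfrac{1}{2\|a\|^2}a+y+z\Bigr)$$ is not $\mathcal{T}$-legal; (2) $8R_0<\dfrac{1}{\|a\|}<(8+\varepsilon)R_0$.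
   Context: Fix an integer $d\ge 1$; $\|\cdot\|$ is the Euclidean norm, $\langle\cdot,\cdot\rangle$ the standard inner product, and $B(x,r)$ the open ball in $\mathbb{R}^d$. A tile is a nonempty bounded open subset of $\mathbb{R}^d$. A patch is a set $\mathcal{P}$ of tiles such that $S\cap T=\emptyset$ for distinct $S,T\in\mathcal{P}$; its support is $\operatorname{supp}\mathcal{P}=\overline{\bigcup_{T\in\mathcal{P}}T}$; a tiling is a patch with support $\mathbb{R}^d$. For a set of tiles $\mathcal{P}$ and $x\in\mathbb{R}^d$, $\mathcal{P}+x=\{T+x\mid T\in\mathcal{P}\}$. For a patch $\mathcal{P}$ and $S\subset\mathbb{R}^d$, $\mathcal{P}\cap S=\{T\in\mathcal{P}\mid T\subset S\}$. A set of tiles $\mathcal{Q}$ (e.g. a patch) is $\mathcal{T}$-legal if $\mathcal{Q}+x\subset\mathcal{T}$ for some $x\in\mathbb{R}^d$. $\mathcal{T}$ has finite tile type with set of proto-tiles $\mathcal{A}$ if $\mathcal{A}$ is a finite set of tiles such that every $T\in\mathcal{T}$ equals $P+x$ for a unique $P\in\mathcal{A}$ and some $x\in\mathbb{R}^d$; $\mathcal{A}$ is always chosen so that $0\in P$ for all $P\in\mathcal{A}$. For $R>0$, $$\Pi_{\mathcal{T},R,\mathcal{A}}=\{(\mathcal{T}-x)\cap B(0,R)\mid x\in\mathbb{R}^d,\ (\mathcal{T}-x)\cap\mathcal{A}\ne\emptyset\},$$ where $(\mathcal{T}-x)\cap\mathcal{A}$ is the ordinary intersection of two sets of tiles. $\mathcal{T}$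 has finite local complexity (FLC) if for every $R>0$ the set $\{\mathcal{T}\cap B(x,R)\mid x\in\mathbb{R}^d\}$ is finite modulo translation. $\mathcal{T}$ is repetitive if for every finite patch $\mathcal{P}\subset\mathcal{T}$ the set $\{x\in\mathbb{R}^d\mid\mathcal{P}+x\subset\mathcal{T}\}$ is relatively dense, i.e. there is $R>0$ such that it meets every ball $B(y,R)$, $y\in\mathbb{R}^d$. On the set of all patches of $\mathbb{R}^d$ use the metric $\rho(\mathcal{P}_1,\mathcal{P}_2)=\inf(\Delta(\mathcal{P}_1,\mathcal{P}_2)\cup\{1/\sqrt2\})$, where $\Delta(\mathcal{P}_1,\mathcal{P}_2)$ is the set of $0<r<1/\sqrt2$ for which there are $x,y\in B(0,r)$ with $(\mathcal{P}_1+x)\cap B(0,1/r)=(\mathcal{P}_2+y)\cap B(0,1/r)$. The continuous hull $X_{\mathcal{T}}$ is the closure of $\{\mathcal{T}+x\mid x\in\mathbb{R}^d\}$ for $\rho$, and $\mathbb{R}^d$ acts on it by $(\mathcal{S},x)\mapsto\mathcal{S}-x$. For $a\in\mathbb{R}^d$ let $\chi_a(x)=e^{2\pi i\langle a,x\rangle}$, so $\operatorname{Ker}\chi_a=\{x\in\mathbb{R}^d\mid\langle a,x\rangle\in\mathbb{Z}\}$. A vector $a$ is a topological eigenvalue for $(X_{\mathcal{T}},\mathbb{R}^d)$ if there is a nonzero continuous $f\colon X_{\mathcal{T}}\to\mathbb{C}$ with $f(\mathcal{S}-x)=\chi_a(x)f(\mathcal{S})$ for all $\mathcal{S}\in X_{\mathcal{T}}$,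 $x\in\mathbb{R}^d$. *)

theory Defs
  imports "HOL-Analysis.Analysis" "HOL-Algebra.Group"
begin

definition tile :: "(real^'d) set \<Rightarrow> bool" where
  "tile T \<longleftrightarrow> T \<noteq> {} \<and> bounded T \<and> open T"

definition patch :: "(real^'d) set set \<Rightarrow> bool" where
  "patch P \<longleftrightarrow> (\<forall>T\<in>P. tile T) \<and> (\<forall>S\<in>P. \<forall>T\<in>P. S \<noteq> T \<longrightarrow> S \<inter> T = {})"

definition supp :: "(real^'d) set set \<Rightarrow> (real^'d) set" where
  "supp P = closure (\<Union>P)"

definition tiling :: "(real^'d) set set \<Rightarrow> bool" where
  "tiling P \<longleftrightarrow> patch P \<and> supp P = UNIV"

definition translate :: "(real^'d) set set \<Rightarrow> real^'d \<Rightarrow> (real^'d) set set" where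
  "translate P x = (\<lambda>T. (+) x ` T) ` P"

text \<open>\<open>restr P S\<close> is what the literature writes as \<open>P \<inter> S\<close>: the tiles of \<open>P\<close> contained in \<open>S\<close>.\<close>

definition restr :: "(real^'d) set set \<Rightarrow> (real^'d) set \<Rightarrow> (real^'d) set set" where
  "restr P S = {T \<in> P. T \<subseteq> S}"

definition legal :: "(real^'d) set set \<Rightarrow> (real^'d) set set \<Rightarrow> bool" where
  "legal T Q \<longleftrightarrow> (\<exists>x. translate Q x \<subseteq> T)"

definition finite_tile_type :: "(real^'d) set set \<Rightarrow> (real^'d) set set \<Rightarrow> bool" where
  "finite_tile_type T \<A> \<longleftrightarrow>
     finite \<A> \<and> (\<forall>P\<in>\<A>. tile P \<and> 0 \<in> P) \<and> (\<forall>S\<in>T. \<exists>!P. P \<in> \<A> \<and> (\<exists>x. S = (+) x ` P))"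

definition Pi_patches :: "(real^'d) set set \<Rightarrow> real \<Rightarrow> (real^'d) set set \<Rightarrow> (real^'d) set set set" where
  "Pi_patches T R \<A> = {restr (translate T (- x)) (ball 0 R) | x. translate T (- x) \<inter> \<A> \<noteq> {}}"

definition finite_mod_translation :: "(real^'d) set set set \<Rightarrow> bool" where
  "finite_mod_translation F \<longleftrightarrow> finite (F // {(P, Q). \<exists>x. Q = translate P x})"

definition FLC :: "(real^'d) set set \<Rightarrow> bool" where
  "FLC T \<longleftrightarrow> (\<forall>R>0. finite_mod_translation {restr T (ball x R) | x. True})"

definition relatively_dense :: "(real^'d) set \<Rightarrow> bool" where
  "relatively_dense S \<longleftrightarrow> (\<exists>R>0. \<forall>y. S \<inter> ball y R \<noteq> {})"

definition repetitive :: "(real^'d) set set \<Rightarrow> bool" where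
  "repetitive T \<longleftrightarrow>
     (\<forall>P. finite P \<and> patch P \<and> P \<subseteq> T \<longrightarrow> relatively_dense {x. translate P x \<subseteq> T})"

definition Delta :: "(real^'d) set set \<Rightarrow> (real^'d) set set \<Rightarrow> real set" where
  "Delta P Q = {r. 0 < r \<and> r < 1 / sqrt 2 \<and>
     (\<exists>x\<in>ball 0 r. \<exists>y\<in>ball 0 r.
        restr (translate P x) (ball 0 (1 / r)) = restr (translate Q y) (ball 0 (1 / r)))}"

definition rho :: "(real^'d) set set \<Rightarrow> (real^'d) set set \<Rightarrow> real" where
  "rho P Q = Inf (Delta P Q \<union> {1 / sqrt 2})"

definition patch_topology :: "(real^'d) set set topology" where
  "patch_topology = Metric_space.mtopology {P. patch P} rho"

definition continuous_hull :: "(real^'d) set set \<Rightarrow> (real^'d) set set set" where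
  "continuous_hull T = Abstract_Topology.closure_of patch_topology (range (translate T))"

definition chi :: "real^'d \<Rightarrow> real^'d \<Rightarrow> complex" where
  "chi a x = exp (2 * of_real pi * \<i> * of_real (a \<bullet> x))"

definition Ker_chi :: "real^'d \<Rightarrow> (real^'d) set" where
  "Ker_chi a = {x. chi a x = 1}"

definition topological_eigenvalue :: "(real^'d) set set \<Rightarrow> real^'d \<Rightarrow> bool" where
  "topological_eigenvalue T a \<longleftrightarrow>
     (\<exists>f :: (real^'d) set set \<Rightarrow> complex.
        continuous_map (subtopology patch_topology (continuous_hull T)) euclidean f \<and>
        (\<exists>S\<in>continuous_hull T. f S \<noteq> 0) \<and>
        (\<forall>S\<in>continuous_hull T. \<forall>x. f (translate S (- x)) = chi a x * f S))"

definition eigenvalue_group :: "(real^'d) set set \<Rightarrow> (real^'d) monoid" where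
  "eigenvalue_group T = \<lparr>carrier = {a. topological_eigenvalue T a}, mult = (+), one = 0\<rparr>"

lemma Ker_chi_eq: "Ker_chi a = {x. a \<bullet> x \<in> \<int>}"
proof -
  have "chi a x = 1 \<longleftrightarrow> a \<bullet> x \<in> \<int>" for x
  proof -
    have "chi a x = 1 \<longleftrightarrow> (\<exists>n::int. 2 * pi * (a \<bullet> x) = of_int (2 * n) * pi)"
      by (simp add: chi_def exp_eq_1)
    also have "\<dots> \<longleftrightarrow> (\<exists>n::int. a \<bullet> x = of_int n)"
    proof -
      have "2 * pi * (a \<bullet> x) = of_int (2 * n) * pi \<longleftrightarrow> a \<bullet> x = of_int n" for n :: int
        by simp
      then show ?thesis by (simp only:)
    qed
    also have "\<dots> \<longleftrightarrow> a \<bullet> x \<in> \<int>"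
      unfolding Ints_def by blast
    finally show ?thesis .
  qed
  then show ?thesis by (simp add: Ker_chi_def)
qed

lemma translate_translate:
  fixes x y :: "real^'d"
  shows "translate (translate P x) y = translate P (x + y)"
proof -
  have "(+) y ` (+) x ` T = (+) (x + y) ` T" for T :: "(real^'d) set"
    unfolding image_image by (rule image_cong) (simp_all add: algebra_simps)
  then show ?thesis by (simp add: translate_def image_image)
qed

lemma translate_zero [simp]: "translate P 0 = P"
  by (simp add: translate_def)

lemma tile_translate: "tile T \<Longrightarrow> tile ((+) x ` T)"
  by (simp add: tile_def bounded_translation open_translation)

lemma patch_translate:
  fixes x :: "real^'d"
  assumes "patch P" shows "patch (translate P x)"
proof -
  have "(+) x ` S \<inter> (+) x ` T = (+) x ` (S \<inter> T)" for S T :: "(real^'d) set"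
    by auto
  then show ?thesis
    using assms tile_translate unfolding patch_def translate_def by (smt (verit) image_empty image_iff)
qed

lemma translate_restr: "translate (restr P S) x = restr (translate P x) ((+) x ` S)"
  by (auto simp: translate_def restr_def)

lemma restr_mono_eq: "restr P S' = restr Q S' \<Longrightarrow> S \<subseteq> S' \<Longrightarrow> restr P S = restr Q S"
  by (auto simp: restr_def set_eq_iff)

lemma Delta_bdd: "bdd_below (Delta P Q \<union> {1 / sqrt 2})"
  by (rule bdd_belowI[of _ 0]) (auto simp: Delta_def)

lemma rho_le: "r \<in> Delta P Q \<Longrightarrow> rho P Q \<le> r"
  unfolding rho_def by (rule cInf_lower[OF _ Delta_bdd]) auto

lemma rho_le_max: "rho P Q \<le> 1 / sqrt 2"
  unfolding rho_def by (rule cInf_lower[OF _ Delta_bdd]) auto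

lemma rho_nonneg: "0 \<le> rho P Q"
  unfolding rho_def by (rule cInf_greatest) (auto simp: Delta_def)

lemma rho_lessD:
  assumes "rho P Q < t" "t \<le> 1 / sqrt 2"
  obtains r where "r \<in> Delta P Q" "r < t"
proof -
  have "\<exists>r\<in>Delta P Q \<union> {1 / sqrt 2}. r < t"
    using assms(1) unfolding rho_def by (intro cInf_lessD) auto
  then show ?thesis using that assms(2) by auto
qed

lemma Delta_sym: "Delta P Q = Delta Q P"
  unfolding Delta_def by (metis (no_types, lifting))

lemma rho_sym: "rho P Q = rho Q P"
  by (simp add: rho_def Delta_sym)

lemma Delta_add:
  assumes "r \<in> Delta P Q" "s \<in> Delta Q U" "r + s < 1 / sqrt 2"
  shows "r + s \<in> Delta P U"
proof -
  obtain x y where xy: "norm x < r" "norm y < r"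
      "restr (translate P x) (ball 0 (1/r)) = restr (translate Q y) (ball 0 (1/r))" and r: "r > 0"
    using assms(1) by (auto simp: Delta_def)
  obtain u v where uv: "norm u < s" "norm v < s"
      "restr (translate Q u) (ball 0 (1/s)) = restr (translate U v) (ball 0 (1/s))" and s: "s > 0"
    using assms(2) by (auto simp: Delta_def)
  have sq: "(r + s)^2 \<le> 1"
  proof -
    have "(r + s)^2 \<le> (1 / sqrt 2)^2" using assms(3) r s by (intro power_mono) auto
    also have "\<dots> \<le> 1" by (simp add: power_divide)
    finally show ?thesis .
  qed
  have bound: "1 / (p + q) + q \<le> 1 / p" if "p > 0" "q > 0" "(p + q)^2 \<le> 1" for p q :: real
  proof -
    have "p * (p + q) \<le> (p + q)^2" using that by (simp add: power2_eq_square algebra_simps)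
    then have *: "p * (p + q) \<le> 1" using that by linarith
    have "1 / p - 1 / (p + q) = q / (p * (p + q))" using that by (simp add: field_simps)
    also have "\<dots> \<ge> q" using * that by (simp add: pos_le_divide_eq mult_left_le)
    finally show ?thesis by simp
  qed
  have sub: "ball 0 (1/(r+s)) \<subseteq> (+) w ` ball 0 (1/p)"
    if "norm w < q" "p > 0" "q > 0" "p + q = r + s" for w :: "real^'d" and p q
  proof
    fix z :: "real^'d" assume z: "z \<in> ball 0 (1/(r+s))"
    have "norm (z - w) \<le> norm z + norm w" by (rule norm_triangle_ineq4)
    also have "\<dots> < 1 / (p + q) + q" using z that by simp
    also have "\<dots> \<le> 1 / p" using bound[of p q] that sq by (simp only:)
    finally have "z - w \<in> ball 0 (1/p)" by simp
    then show "z \<in> (+) w ` ball 0 (1/p)" by (rule rev_image_eqI) simp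
  qed
  have "restr (translate P (x + u)) ((+) u ` ball 0 (1/r)) = restr (translate Q (y + u)) ((+) u ` ball 0 (1/r))"
    using arg_cong[OF xy(3), of "\<lambda>Z. translate Z u"] by (simp add: translate_restr translate_translate)
  then have 1: "restr (translate P (x + u)) (ball 0 (1/(r+s))) = restr (translate Q (y + u)) (ball 0 (1/(r+s)))"
    by (rule restr_mono_eq) (rule sub[OF uv(1)], use r s in auto)
  have "restr (translate Q (u + y)) ((+) y ` ball 0 (1/s)) = restr (translate U (v + y)) ((+) y ` ball 0 (1/s))"
    using arg_cong[OF uv(3), of "\<lambda>Z. translate Z y"] by (simp add: translate_restr translate_translate)
  then have 2: "restr (translate Q (u + y)) (ball 0 (1/(r+s))) = restr (translate U (v + y)) (ball 0 (1/(r+s)))"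
    by (rule restr_mono_eq) (rule sub[OF xy(2)], use r s in auto)
  have n: "norm (x + u) < r + s" "norm (v + y) < r + s"
    using norm_triangle_ineq[of x u] norm_triangle_ineq[of v y] xy uv by linarith+
  have "restr (translate P (x + u)) (ball 0 (1/(r+s))) = restr (translate U (v + y)) (ball 0 (1/(r+s)))"
    using 1 2 by (simp add: add.commute)
  then show ?thesis
    using n assms(3) r s unfolding Delta_def mem_Collect_eq
    by (intro conjI bexI[of _ "x + u"] bexI[of _ "v + y"]) simp_all
qed

lemma rho_triangle: "rho P U \<le> rho P Q + rho Q U"
proof (rule ccontr)
  assume "\<not> ?thesis"
  then have lt: "rho P Q + rho Q U < rho P U" by simp
  define e where "e = (rho P U - (rho P Q + rho Q U)) / 2"
  have e: "e > 0" using lt by (simp add: e_def)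
  have le: "rho P Q + e \<le> 1 / sqrt 2" "rho Q U + e \<le> 1 / sqrt 2"
    using rho_le_max[of P U] rho_nonneg[of P Q] rho_nonneg[of Q U] e
    unfolding e_def by argo+
  obtain r where r: "r \<in> Delta P Q" "r < rho P Q + e" by (rule rho_lessD[OF _ le(1)]) (use e in auto)
  obtain s where s: "s \<in> Delta Q U" "s < rho Q U + e" by (rule rho_lessD[OF _ le(2)]) (use e in auto)
  have rs: "r + s < rho P U" using r(2) s(2) by (simp add: e_def field_simps)
  then have "r + s < 1 / sqrt 2" using rho_le_max[of P U] by linarith
  from rho_le[OF Delta_add[OF r(1) s(1) this]] rs show False by simp
qed

lemma translation_eq_self_bounded:
  fixes T :: "(real^'d) set"
  assumes "bounded T" "T \<noteq> {}" "(+) w ` T = T"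
  shows "w = 0"
proof (rule ccontr)
  assume w: "w \<noteq> 0"
  obtain p where p: "p \<in> T" using assms(2) by auto
  have mem: "p + real n *\<^sub>R w \<in> T" for n
  proof (induction n)
    case (Suc n)
    then have "w + (p + real n *\<^sub>R w) \<in> (+) w ` T" by blast
    then have "w + (p + real n *\<^sub>R w) \<in> T" unfolding assms(3) .
    then show ?case by (simp add: algebra_simps)
  qed (use p in simp)
  obtain M where M: "\<And>x. x \<in> T \<Longrightarrow> norm x \<le> M" using assms(1) by (auto simp: bounded_iff)
  obtain n :: nat where n: "2 * M < real n * norm w" using w by (metis reals_Archimedean3 zero_less_norm_iff)
  have "real n * norm w = norm ((p + real n *\<^sub>R w) - p)" by simp
  also have "\<dots> \<le> norm (p + real n *\<^sub>R w) + norm p" by (rule norm_triangle_ineq4)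
  also have "\<dots> \<le> 2 * M" using M[OF mem[of n]] M[OF p] by simp
  finally show False using n by simp
qed

lemma rho_eq_0_subset:
  assumes P: "patch P" and Q: "patch Q" and 0: "rho P Q = 0"
  shows "P \<subseteq> Q"
proof
  fix T assume T: "T \<in> P"
  then have t: "tile T" using P by (auto simp: patch_def)
  obtain M where M: "M > 0" "\<And>x. x \<in> T \<Longrightarrow> norm x \<le> M"
    using t by (auto simp: tile_def bounded_pos)
  have near: "\<exists>u. norm u < e \<and> (+) u ` T \<in> Q" if e: "e > 0" for e
  proof -
    define t where "t = min (min (e/2) (1/(M+1))) (1 / sqrt 2)"
    have tpos: "0 < t" using e M(1) by (simp add: t_def)
    obtain r where r: "r \<in> Delta P Q" "r < t" by (rule rho_lessD[of P Q t]) (use 0 tpos in \<open>auto simp: t_def\<close>)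
    then obtain x y where xy: "norm x < r" "norm y < r"
      "restr (translate P x) (ball 0 (1/r)) = restr (translate Q y) (ball 0 (1/r))" and r0: "r > 0"
      by (auto simp: Delta_def)
    have "r < 1 / (M + 1)" using r(2) by (simp add: t_def)
    then have Mr: "M + 1 < 1 / r" using r0 M(1) by (simp add: field_simps)
    have "1 / sqrt 2 \<le> (1::real)" by simp
    then have r1: "r < 1" using r(2) unfolding t_def by linarith
    have "norm (x + z) < 1 / r" if "z \<in> T" for z
      using norm_triangle_ineq[of x z] M(2)[OF that] xy(1) r1 Mr by linarith
    then have "(+) x ` T \<in> restr (translate P x) (ball 0 (1/r))"
      using T by (auto simp: restr_def translate_def)
    then have "(+) x ` T \<in> translate Q y"
      unfolding xy(3) by (simp add: restr_def)
    then obtain S where S: "S \<in> Q" "(+) x ` T = (+) y ` S"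
      by (auto simp: translate_def)
    have "(+) (x - y) ` T = (+) (- y) ` (+) x ` T"
      unfolding image_image by (rule image_cong) (simp_all add: algebra_simps)
    also have "\<dots> = S" by (simp add: S(2) image_image)
    finally have "(+) (x - y) ` T \<in> Q" using S by simp
    moreover have "norm (x - y) < e"
      using norm_triangle_ineq4[of x y] xy r(2) by (simp add: t_def)
    ultimately show ?thesis by blast
  qed
  obtain p where p: "p \<in> T" using t by (auto simp: tile_def)
  obtain d where d: "d > 0" "ball p d \<subseteq> T" using t p by (meson tile_def openE)
  obtain u where u: "norm u < d/2" "(+) u ` T \<in> Q" using near[of "d/2"] d by auto
  show "T \<in> Q"
  proof (cases "u = 0")
    case True
    then show ?thesis using u by simp
  next
    case False
    then obtain v where v: "norm v < min (norm u) (d/2)" "(+) v ` T \<in> Q"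
      using near[of "min (norm u) (d/2)"] d by auto
    have "norm (u - v) < d" using norm_triangle_ineq4[of u v] u v by linarith
    then have "p + (u - v) \<in> ball p d" by (simp add: dist_norm norm_minus_commute)
    then have "p + (u - v) \<in> T" using d(2) by blast
    then have "v + (p + (u - v)) \<in> (+) v ` T" by blast
    then have "p + u \<in> (+) v ` T" by (simp add: algebra_simps)
    moreover have "p + u \<in> (+) u ` T" using p by (simp add: image_iff algebra_simps)
    ultimately have "(+) u ` T \<inter> (+) v ` T \<noteq> {}" by (metis IntI empty_iff)
    then have "(+) u ` T = (+) v ` T" using Q u(2) v(2) unfolding patch_def by metis
    then have "(+) (-v) ` (+) u ` T = (+) (-v) ` (+) v ` T" by (rule arg_cong)
    moreover have "(+) (-v) ` (+) u ` T = (+) (u - v) ` T"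
      unfolding image_image by (rule image_cong) (simp_all add: algebra_simps)
    moreover have "(+) (-v) ` (+) v ` T = T" by (simp add: image_image)
    ultimately have "(+) (u - v) ` T = T" by simp
    then have "u - v = 0" using t translation_eq_self_bounded[of T "u - v"] by (simp add: tile_def)
    then show ?thesis using v by simp
  qed
qed

lemma rho_refl: "rho P P = 0"
proof (rule antisym[OF _ rho_nonneg], rule field_le_epsilon)
  fix e :: real assume "e > 0"
  have "(1::real) / 2 < 1 / sqrt 2" using sqrt2_less_2 by (simp add: field_simps)
  then have "min (e/2) (1/2) < 1 / sqrt 2" by linarith
  with \<open>e > 0\<close> have "min (e/2) (1/2) \<in> Delta P P"
    unfolding Delta_def mem_Collect_eq by (intro conjI bexI[of _ 0]) auto
  from rho_le[OF this] show "rho P P \<le> 0 + e" using \<open>e > 0\<close> by simp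
qed

lemma Metric_space_patches: "Metric_space {P. patch P} rho"
proof
  fix P Q :: "(real^'d) set set" assume PQ: "P \<in> {P. patch P}" "Q \<in> {P. patch P}"
  show "rho P Q = 0 \<longleftrightarrow> P = Q"
  proof
    assume "rho P Q = 0"
    then show "P = Q"
      using PQ rho_eq_0_subset[of P Q] rho_eq_0_subset[of Q P] by (simp add: rho_sym[of Q P])
  qed (simp add: rho_refl)
qed (rule rho_nonneg rho_sym rho_triangle)+

lemma topspace_patch_topology [simp]: "topspace patch_topology = {P. patch P}"
  unfolding patch_topology_def by (rule Metric_space.topspace_mtopology[OF Metric_space_patches])

lemma translate_in_hull:
  assumes "patch T" shows "translate T x \<in> continuous_hull T"
proof -
  have "range (translate T) \<subseteq> topspace patch_topology" using assms patch_translate by auto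
  from closure_of_subset[OF this] have "range (translate T) \<subseteq> continuous_hull T"
    unfolding continuous_hull_def .
  then show ?thesis by (rule subsetD) (rule rangeI)
qed

lemma eigenfunction_nonvanishing:
  fixes f :: "(real^'d) set set \<Rightarrow> complex"
  assumes T: "patch T"
    and cont: "continuous_map (subtopology patch_topology (continuous_hull T)) euclidean f"
    and nz: "\<exists>S\<in>continuous_hull T. f S \<noteq> 0"
    and eq: "\<forall>S\<in>continuous_hull T. \<forall>x. f (translate S (- x)) = chi a x * f S"
    and S: "S \<in> continuous_hull T"
  shows "f S \<noteq> 0"
proof -
  let ?X = "subtopology patch_topology (continuous_hull T)"
  have T0: "T \<in> continuous_hull T" using translate_in_hull[OF T, of 0] by simp
  have hs: "continuous_hull T \<subseteq> topspace patch_topology" unfolding continuous_hull_def by (rule closure_of_subset_topspace)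
  have top: "topspace ?X = continuous_hull T" using hs by (rule topspace_subtopology_subset)
  have rng: "range (translate T) \<subseteq> continuous_hull T" using translate_in_hull[OF T] by auto
  have cl: "Abstract_Topology.closure_of ?X (range (translate T)) = continuous_hull T"
    using rng closure_of_subtopology_open[of patch_topology "continuous_hull T" "range (translate T)"]
    by (metis continuous_hull_def inf.idem)
  have norm_chi: "cmod (chi a x) = 1" for x by (simp add: chi_def)
  have "closedin ?X {S \<in> topspace ?X. f S \<in> {z. cmod z = cmod (f T)}}"
    by (rule closedin_continuous_map_preimage[OF cont])
      (auto intro: closed_Collect_eq continuous_intros)
  then have cs: "closedin ?X {S \<in> topspace ?X. cmod (f S) = cmod (f T)}" by simp
  have const: "cmod (f S) = cmod (f T)" if "S \<in> continuous_hull T" for S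
  proof (rule forall_in_closure_of[OF _ _ cs])
    show "S \<in> Abstract_Topology.closure_of ?X (range (translate T))" using that cl by simp
    show "cmod (f S) = cmod (f T)" if SR: "S \<in> range (translate T)" for S
    proof -
      obtain y where "S = translate T y" using SR by blast
      then obtain x where x: "S = translate T (- x)" by (metis minus_minus)
      have "f S = chi a x * f T" unfolding x using eq T0 by blast
      then show ?thesis by (simp add: norm_mult norm_chi)
    qed
  qed
  show ?thesis using const[OF S] const nz by force
qed

lemma topological_eigenvalue_0: "patch T \<Longrightarrow> topological_eigenvalue T 0"
  unfolding topological_eigenvalue_def
  using translate_in_hull[of T 0] by (intro exI[of _ "\<lambda>_. 1"] conjI bexI[of _ T]) (simp_all add: chi_def)

lemma topological_eigenvalue_add:
  assumes T: "patch T" and "topological_eigenvalue T a" "topological_eigenvalue T b"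
  shows "topological_eigenvalue T (a + b)"
proof -
  let ?X = "subtopology patch_topology (continuous_hull T)"
  obtain f where f: "continuous_map ?X euclidean f" "\<exists>S\<in>continuous_hull T. f S \<noteq> 0"
      "\<forall>S\<in>continuous_hull T. \<forall>x. f (translate S (- x)) = chi a x * f S"
    using assms(2) unfolding topological_eigenvalue_def by blast
  obtain g where g: "continuous_map ?X euclidean g" "\<exists>S\<in>continuous_hull T. g S \<noteq> 0"
      "\<forall>S\<in>continuous_hull T. \<forall>x. g (translate S (- x)) = chi b x * g S"
    using assms(3) unfolding topological_eigenvalue_def by blast
  have "chi (a + b) x = chi a x * chi b x" for x
    by (simp add: chi_def inner_add_left algebra_simps flip: exp_add)
  moreover have "continuous_map ?X euclidean (\<lambda>S. f S * g S)"
    using f(1) g(1) by (simp add: continuous_map_atin tendsto_mult)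
  moreover have "f T * g T \<noteq> 0"
    using eigenfunction_nonvanishing[OF T f] eigenfunction_nonvanishing[OF T g]
      translate_in_hull[OF T, of 0] by simp
  ultimately show ?thesis
    unfolding topological_eigenvalue_def using f(3) g(3) translate_in_hull[OF T, of 0]
    by (intro exI[of _ "\<lambda>S. f S * g S"] conjI bexI[of _ T]) simp_all
qed

lemma topological_eigenvalue_minus:
  assumes "topological_eigenvalue T a"
  shows "topological_eigenvalue T (- a)"
proof -
  let ?X = "subtopology patch_topology (continuous_hull T)"
  obtain f where f: "continuous_map ?X euclidean f" "\<exists>S\<in>continuous_hull T. f S \<noteq> 0"
      "\<forall>S\<in>continuous_hull T. \<forall>x. f (translate S (- x)) = chi a x * f S"
    using assms unfolding topological_eigenvalue_def by blast
  have "chi (- a) x = cnj (chi a x)" for x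
    by (simp add: chi_def exp_cnj)
  moreover have "continuous_map ?X euclidean (\<lambda>S. cnj (f S))"
    using f(1) by (simp add: continuous_map_atin tendsto_cnj)
  ultimately show ?thesis
    unfolding topological_eigenvalue_def using f(2,3)
    by (intro exI[of _ "\<lambda>S. cnj (f S)"] conjI) simp_all
qed

lemma group_eigenvalue_group:
  assumes "patch T" shows "group (eigenvalue_group T)"
proof (rule groupI)
  fix a assume "a \<in> carrier (eigenvalue_group T)"
  then show "\<exists>b\<in>carrier (eigenvalue_group T). b \<otimes>\<^bsub>eigenvalue_group T\<^esub> a = \<one>\<^bsub>eigenvalue_group T\<^esub>"
    by (intro bexI[of _ "- a"]) (auto simp: eigenvalue_group_def topological_eigenvalue_minus)
qed (use assms in \<open>auto simp: eigenvalue_group_def topological_eigenvalue_0 topological_eigenvalue_add\<close>)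

end

theory Submission
  imports Defs
begin

text \<open>
  A topological eigenvalue \<open>a\<close> forces a finite patch to be a clock. If \<open>f\<close> is an eigenfunction
  for \<open>a\<close>, then \<open>f (T - u) = \<chi>\<^sub>a(u) f T\<close> with \<open>f T \<noteq> 0\<close>; and if \<open>T - u\<close> agrees with \<open>T\<close> on a
  large ball about the origin, continuity of \<open>f\<close> at the single point \<open>T\<close> makes \<open>\<chi>\<^sub>a(u)\<close> close
  to \<open>1\<close>. Hence there is a patch \<open>Q \<subseteq> T\<close>, consisting of the tiles of \<open>T\<close> in a large ball, such
  that \<open>Q + u \<subseteq> T\<close> implies \<open>|\<chi>\<^sub>a(u) - 1| < 1/2\<close>
  (\<open>occurrence_of_central_patch_determines_character\<close>).

  The patch \<open>Q\<close> is finite, so repetitivity places a translate of it in every sufficiently large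
  patch \<open>P\<close> of \<open>T\<close> (\<open>repetitive_large_patches_contain\<close>); let \<open>x(P)\<close> be a vector that moves such a
  translate back to \<open>Q\<close>, so that \<open>Q \<subseteq> P + x(P)\<close>. If the union in the theorem were legal, there
  would be a \<open>w\<close> with both \<open>Q + w \<subseteq> T\<close> and \<open>Q + w + a/(2|a|\<^sup>2) + y + z \<subseteq> T\<close>. Therefore
  \<open>\<chi>\<^sub>a(w)\<close> and \<open>-\<chi>\<^sub>a(w) \<chi>\<^sub>a(z)\<close> would both be within \<open>1/2\<close> of \<open>1\<close>, because
  \<open>\<chi>\<^sub>a(a/(2|a|\<^sup>2)) = -1\<close> and \<open>\<chi>\<^sub>a(y) = 1\<close>. But \<open>|\<langle>a, z\<rangle>| < |a| R0 < 1/8\<close>, so \<open>\<chi>\<^sub>a(z)\<close> lies in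
  the right half plane, and these two bounds contradict each other.

  It remains to find \<open>a\<close> with \<open>1/|a|\<close> in the prescribed interval: a suitable multiple of a very
  short nonzero element of \<open>A\<close> (\<open>multiple_with_norm_between\<close>).
\<close>

section \<open>Tilings of finite tile type\<close>

lemma tile_translate_of_prototile:
  assumes "finite_tile_type T \<A>" "S \<in> T"
  obtains P v where "P \<in> \<A>" "S = (+) v ` P"
proof -
  have "\<exists>!P. P \<in> \<A> \<and> (\<exists>v. S = (+) v ` P)"
    using assms by (simp add: finite_tile_type_def)
  then show ?thesis using that by (elim ex1E conjE exE)
qed

lemma finite_tile_type_diameter_bound:
  fixes T :: "(real^'d) set set"
  assumes "finite_tile_type T \<A>"
  obtains D where "D > 0" "\<And>S p q. S \<in> T \<Longrightarrow> p \<in> S \<Longrightarrow> q \<in> S \<Longrightarrow> dist p q < D"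
proof -
  have "bounded (\<Union>\<A>)"
    using assms by (intro bounded_Union) (auto simp: finite_tile_type_def tile_def)
  then obtain M where M: "M > 0" "\<And>x. x \<in> \<Union>\<A> \<Longrightarrow> norm x \<le> M"
    by (auto simp: bounded_pos)
  show ?thesis
  proof
    show "2 * M + 1 > 0" using M(1) by simp
    fix S p q assume S: "S \<in> T" and pq: "p \<in> S" "q \<in> S"
    obtain P v where P: "P \<in> \<A>" "S = (+) v ` P"
      using tile_translate_of_prototile[OF assms S] .
    obtain p' q' where "p' \<in> P" "q' \<in> P" "p = v + p'" "q = v + q'" using pq P(2) by blast
    moreover from this have "norm p' \<le> M" "norm q' \<le> M" using M(2) P(1) by blast+
    ultimately show "dist p q < 2 * M + 1"
      using norm_triangle_ineq4[of p' q'] by (simp add: dist_norm)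
  qed
qed

lemma finite_tile_type_inner_radius:
  fixes T :: "(real^'d) set set"
  assumes "finite_tile_type T \<A>"
  obtains c where "c > 0" "\<And>S. S \<in> T \<Longrightarrow> \<exists>p. ball p c \<subseteq> S"
proof -
  have fin: "finite \<A>" and A: "\<And>P. P \<in> \<A> \<Longrightarrow> open P \<and> 0 \<in> P"
    using assms by (auto simp: finite_tile_type_def tile_def)
  have "open (\<Inter>\<A>)" "0 \<in> \<Inter>\<A>" using fin A by (auto intro: open_Inter)
  then obtain c where c: "c > 0" "ball 0 c \<subseteq> \<Inter>\<A>" by (meson openE)
  show ?thesis
  proof
    show "c > 0" by fact
    fix S assume "S \<in> T"
    then obtain P v where P: "P \<in> \<A>" "S = (+) v ` P"
      using tile_translate_of_prototile[OF assms] by metis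
    have "ball v c = (+) v ` ball 0 c" by (simp add: ball_translation[of v 0 c, symmetric])
    then show "\<exists>p. ball p c \<subseteq> S" using c(2) P by blast
  qed
qed

text \<open>
  Centres of balls of a common radius inscribed in disjoint tiles are uniformly separated, so only
  finitely many of them lie in a bounded region. This finiteness is what makes repetitivity
  applicable to the patch in a ball.
\<close>

lemma finite_restr_bounded:
  fixes T :: "(real^'d) set set"
  assumes "patch T" "finite_tile_type T \<A>" "bounded B"
  shows "finite (restr T B)"
proof -
  obtain c where c: "c > 0" "\<And>S. S \<in> T \<Longrightarrow> \<exists>p. ball p c \<subseteq> S"
    using finite_tile_type_inner_radius[OF assms(2)] by blast
  then obtain p where p: "\<And>S. S \<in> T \<Longrightarrow> ball (p S) c \<subseteq> S" by metis
  have pS: "p S \<in> S" if "S \<in> T" for S using p[OF that] c(1) by auto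
  have sep: "S = S'" if "S \<in> T" "S' \<in> T" "dist (p S) (p S') < c" for S S'
  proof -
    have "p S' \<in> S" using p[OF that(1)] that(3) by auto
    then have "S \<inter> S' \<noteq> {}" using pS[OF that(2)] by blast
    then show ?thesis using assms(1) that(1,2) unfolding patch_def by blast
  qed
  have "inj_on p (restr T B)"
  proof (rule inj_onI)
    fix S S' assume "S \<in> restr T B" "S' \<in> restr T B" "p S = p S'"
    then show "S = S'" using c(1) by (intro sep) (simp_all add: restr_def)
  qed
  moreover have "bounded (p ` restr T B)"
  proof (rule bounded_subset[OF assms(3)], clarify)
    fix S assume "S \<in> restr T B"
    then show "p S \<in> B" using pS[of S] by (auto simp: restr_def)
  qed
  moreover have "uniform_discrete (p ` restr T B)"
    unfolding uniform_discrete_def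
  proof (intro exI[of _ c] conjI c(1) ballI impI)
    fix x y assume "x \<in> p ` restr T B" "y \<in> p ` restr T B" "dist x y < c"
    then obtain S S' where S: "S \<in> T" "S' \<in> T" "x = p S" "y = p S'"
      by (auto simp: restr_def)
    moreover have "S = S'" by (rule sep) (use S \<open>dist x y < c\<close> in simp_all)
    ultimately show "x = y" by simp
  qed
  ultimately show ?thesis
    using uniform_discrete_finite_iff[of "p ` restr T B"] by (simp add: finite_image_iff)
qed

text \<open>
  Containing the tiles of a tiling in a ball already means agreeing with it on a slightly smaller
  ball: the tiles of a tiling leave no room for further disjoint tiles.
\<close>

lemma restr_eq_if_contains_larger_restr:
  fixes T T' :: "(real^'d) set set"
  assumes T: "tiling T" and T': "patch T'" and D: "D > 0"
    and diam: "\<And>S p q. S \<in> T \<Longrightarrow> p \<in> S \<Longrightarrow> q \<in> S \<Longrightarrow> dist p q < D"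
    and sub: "restr T (ball 0 (r + D)) \<subseteq> T'"
  shows "restr T (ball 0 r) = restr T' (ball 0 r)"
proof (intro equalityI subsetI)
  fix S assume "S \<in> restr T (ball 0 r)"
  moreover have "ball 0 r \<subseteq> ball (0::real^'d) (r + D)" using D by auto
  ultimately show "S \<in> restr T' (ball 0 r)" using sub by (auto simp: restr_def)
next
  fix S assume "S \<in> restr T' (ball 0 r)"
  then have S: "S \<in> T'" "S \<subseteq> ball 0 r" by (auto simp: restr_def)
  then have "open S" "S \<noteq> {}" using T' by (auto simp: patch_def tile_def)
  moreover have "closure (\<Union>T) = UNIV" using T by (simp add: tiling_def supp_def)
  ultimately have "S \<inter> \<Union>T \<noteq> {}"
    using open_Int_closure_eq_empty[of S "\<Union>T"] by simp
  then obtain U p where U: "U \<in> T" "p \<in> S" "p \<in> U" by blast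
  have "U \<subseteq> ball 0 (r + D)"
  proof
    fix q assume "q \<in> U"
    then have "dist p q < D" by (rule diam[OF U(1,3)])
    moreover have "dist 0 p < r" using S U by auto
    ultimately show "q \<in> ball 0 (r + D)" using dist_triangle[of 0 q p] by simp
  qed
  then have "U \<in> T'" using sub U(1) by (auto simp: restr_def)
  moreover have "S \<inter> U \<noteq> {}" using U(2,3) by blast
  ultimately have "S = U" using T' S(1) by (auto simp: patch_def)
  then show "S \<in> restr T (ball 0 r)" using S U by (simp add: restr_def)
qed

section \<open>Eigenvalues and the occurrences of a patch\<close>

lemma chi_add: "chi a (x + y) = chi a x * chi a y"
  by (simp add: chi_def inner_add_right algebra_simps flip: exp_add)

lemma norm_chi [simp]: "cmod (chi a x) = 1"
  by (simp add: chi_def)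

lemma chi_half_period:
  assumes "a \<noteq> 0"
  shows "chi a ((1 / (2 * (norm a)\<^sup>2)) *\<^sub>R a) = - 1"
proof -
  have "a \<bullet> ((1 / (2 * (norm a)\<^sup>2)) *\<^sub>R a) = 1 / 2"
    using assms by (simp add: power2_norm_eq_inner)
  then show ?thesis by (simp add: chi_def exp_pi_i)
qed

lemma Re_chi_nonneg:
  assumes "\<bar>a \<bullet> z\<bar> \<le> 1 / 4"
  shows "Re (chi a z) \<ge> 0"
proof -
  have "chi a z = cis (2 * pi * (a \<bullet> z))" by (simp add: chi_def cis_conv_exp algebra_simps)
  moreover have "\<bar>2 * pi * (a \<bullet> z)\<bar> \<le> pi / 2"
    using assms mult_left_mono[of "\<bar>a \<bullet> z\<bar>" "1/4" "2 * pi"] by (simp add: abs_mult)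
  then have "cos (2 * pi * (a \<bullet> z)) \<ge> 0" by (intro cos_ge_zero) linarith+
  ultimately show ?thesis by simp
qed

text \<open>
  Only agreement without any shift is considered, that is, the vectors \<open>x\<close> and \<open>y\<close> in the
  definition of \<open>Delta\<close> are both \<open>0\<close>.
\<close>

lemma rho_less_if_restr_eq:
  assumes "0 < r" "r < 1 / sqrt 2" "r < s"
    and "restr P (ball 0 (1 / r)) = restr Q (ball 0 (1 / r))"
  shows "rho P Q < s"
proof -
  have "r \<in> Delta P Q"
    using assms unfolding Delta_def by (auto intro!: bexI[of _ 0])
  then show ?thesis using rho_le[of r P Q] assms(3) by linarith
qed

lemma continuous_on_hull_at:
  fixes f :: "(real^'d) set set \<Rightarrow> complex"
  assumes cont: "continuous_map (subtopology patch_topology (continuous_hull T)) euclidean f"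
    and S: "S \<in> continuous_hull T" and e: "e > 0"
  obtains s where "s > 0"
    "\<And>S'. S' \<in> continuous_hull T \<Longrightarrow> rho S S' < s \<Longrightarrow> cmod (f S' - f S) < e"
proof -
  interpret M: Metric_space "{P :: (real^'d) set set. patch P}" rho by (rule Metric_space_patches)
  let ?X = "subtopology patch_topology (continuous_hull T)"
  have hs: "continuous_hull T \<subseteq> topspace patch_topology"
    unfolding continuous_hull_def by (rule closure_of_subset_topspace)
  then have top: "topspace ?X = continuous_hull T" by (rule topspace_subtopology_subset)
  have "openin ?X {S' \<in> topspace ?X. f S' \<in> ball (f S) e}"
    by (rule openin_continuous_map_preimage[OF cont]) simp
  then have "\<exists>U. openin M.mtopology U \<and>
      {S' \<in> continuous_hull T. f S' \<in> ball (f S) e} = U \<inter> continuous_hull T"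
    unfolding top openin_subtopology unfolding patch_topology_def .
  then obtain U where U: "openin M.mtopology U"
    "{S' \<in> continuous_hull T. f S' \<in> ball (f S) e} = U \<inter> continuous_hull T"
    by (elim exE conjE)
  have iff: "f S' \<in> ball (f S) e \<longleftrightarrow> S' \<in> U" if "S' \<in> continuous_hull T" for S'
    using that eqset_imp_iff[OF U(2), of S'] by simp
  have "S \<in> U" using iff[OF S] e by simp
  then obtain s where s: "s > 0" "M.mball S s \<subseteq> U" using U(1) unfolding M.openin_mtopology by metis
  show ?thesis
  proof
    show "s > 0" by fact
    fix S' assume S': "S' \<in> continuous_hull T" "rho S S' < s"
    have "patch S" "patch S'" using S S'(1) hs by auto
    then have "S' \<in> M.mball S s" using S'(2) by (simp add: M.in_mball)
    then have "f S' \<in> ball (f S) e" unfolding iff[OF S'(1)] by (rule subsetD[OF s(2)])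
    then show "cmod (f S' - f S) < e" by (simp add: dist_norm norm_minus_commute)
  qed
qed

text \<open>
  The central patch of \<open>T\<close> can recur only at near-periods of \<open>\<chi>\<^sub>a\<close>: where it recurs, \<open>T - u\<close> is
  close to \<open>T\<close>, so \<open>f (T - u) = \<chi>\<^sub>a(u) f T\<close> is close to \<open>f T \<noteq> 0\<close>. The radius exceeds the one
  that continuity of \<open>f\<close> at \<open>T\<close> demands by a bound for the tile diameters, so that containment of
  the patch gives agreement on the smaller ball.
\<close>

lemma occurrence_of_central_patch_determines_character:
  fixes T :: "(real^'d) set set"
  assumes T: "tiling T" and type: "finite_tile_type T \<A>"
    and eig: "topological_eigenvalue T a" and e: "e > 0"
  obtains r where "r > 0"
    "\<And>u. translate (restr T (ball 0 r)) u \<subseteq> T \<Longrightarrow> cmod (chi a u - 1) < e"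
proof -
  have pT: "patch T" using T by (simp add: tiling_def)
  have hull: "translate T u \<in> continuous_hull T" for u by (rule translate_in_hull[OF pT])
  have T0: "T \<in> continuous_hull T" using hull[of 0] by simp
  obtain f where f: "continuous_map (subtopology patch_topology (continuous_hull T)) euclidean f"
      "\<exists>S\<in>continuous_hull T. f S \<noteq> 0"
      "\<forall>S\<in>continuous_hull T. \<forall>x. f (translate S (- x)) = chi a x * f S"
    using eig unfolding topological_eigenvalue_def by blast
  have fT: "f T \<noteq> 0" by (rule eigenfunction_nonvanishing[OF pT f T0])
  obtain s where s: "s > 0"
      "\<And>S. S \<in> continuous_hull T \<Longrightarrow> rho T S < s \<Longrightarrow> cmod (f S - f T) < e * cmod (f T)"
    using continuous_on_hull_at[OF f(1) T0, of "e * cmod (f T)"] e fT by auto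
  obtain D where D: "D > 0" "\<And>S p q. S \<in> T \<Longrightarrow> p \<in> S \<Longrightarrow> q \<in> S \<Longrightarrow> dist p q < D"
    using finite_tile_type_diameter_bound[OF type] by blast
  define t where "t = min (s / 2) (1 / 2)"
  have "(1::real) / 2 < 1 / sqrt 2" using sqrt2_less_2 by (simp add: field_simps)
  moreover have "t \<le> 1 / 2" "t \<le> s / 2" "0 < t" using s(1) by (auto simp: t_def)
  ultimately have t: "0 < t" "t < 1 / sqrt 2" "t < s" using s(1) by linarith+
  show ?thesis
  proof
    show "1 / t + D > 0" using t(1) D(1) by (simp add: add_pos_pos)
    fix u assume u: "translate (restr T (ball 0 (1 / t + D))) u \<subseteq> T"
    have "translate (translate (restr T (ball 0 (1 / t + D))) u) (- u) \<subseteq> translate T (- u)"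
      using u unfolding translate_def by (rule image_mono)
    then have "restr T (ball 0 (1 / t + D)) \<subseteq> translate T (- u)"
      by (simp add: translate_translate)
    then have "restr T (ball 0 (1 / t)) = restr (translate T (- u)) (ball 0 (1 / t))"
      by (intro restr_eq_if_contains_larger_restr[OF T patch_translate[OF pT] D(1)] D(2))
    then have "rho T (translate T (- u)) < s" by (rule rho_less_if_restr_eq[OF t])
    then have "cmod (f (translate T (- u)) - f T) < e * cmod (f T)" by (rule s(2)[OF hull])
    moreover have "f (translate T (- u)) - f T = (chi a u - 1) * f T"
      using f(3) T0 by (simp add: algebra_simps)
    ultimately show "cmod (chi a u - 1) < e" using fT by (simp add: norm_mult)
  qed
qed

section \<open>Repetitivity\<close>

lemma repetitive_large_patches_contain:
  fixes T :: "(real^'d) set set"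
  assumes rep: "repetitive T" and pT: "patch T" and Q: "finite Q" "Q \<subseteq> T" "\<Union>Q \<subseteq> ball 0 r"
    and r: "r > 0"
  obtains R where "R > 0"
    "\<And>L v. L > R \<Longrightarrow> \<exists>x. Q \<subseteq> translate (restr (translate T (- v)) (ball 0 L)) x"
proof -
  have "patch Q" using pT subsetD[OF Q(2)] by (simp add: patch_def)
  then have "relatively_dense {u. translate Q u \<subseteq> T}"
    using rep Q(1,2) by (simp add: repetitive_def)
  then obtain R' where R': "R' > 0" "\<forall>v. {u. translate Q u \<subseteq> T} \<inter> ball v R' \<noteq> {}"
    unfolding relatively_dense_def by (elim exE conjE)
  show ?thesis
  proof
    show "R' + r > 0" using R'(1) r by simp
    fix L v assume L: "L > R' + r"
    obtain u where u: "translate Q u \<subseteq> T" "dist v u < R'" using R'(2)[rule_format, of v] by auto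
    have "Q \<subseteq> translate (restr (translate T (- v)) (ball 0 L)) (v - u)"
    proof
      fix S assume S: "S \<in> Q"
      have "(+) u ` S \<in> T" using S u(1) by (auto simp: translate_def)
      then have "(+) (- v) ` (+) u ` S \<in> translate T (- v)" by (auto simp: translate_def)
      moreover have "(+) (- v) ` (+) u ` S \<subseteq> ball 0 L"
      proof clarsimp
        fix p assume "p \<in> S"
        then have "norm p < r" using Q(3) S by auto
        then show "norm (u + p - v) < L"
          using norm_triangle_ineq[of "u - v" p] u(2) L
          by (simp add: dist_norm norm_minus_commute algebra_simps)
      qed
      ultimately have "(+) (- v) ` (+) u ` S \<in> restr (translate T (- v)) (ball 0 L)"
        by (simp add: restr_def)
      moreover have "S = (+) (v - u) ` (+) (- v) ` (+) u ` S"
        by (simp add: image_image)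
      ultimately show "S \<in> translate (restr (translate T (- v)) (ball 0 L)) (v - u)"
        unfolding translate_def[of _ "v - u"] by (rule rev_image_eqI)
    qed
    then show "\<exists>x. Q \<subseteq> translate (restr (translate T (- v)) (ball 0 L)) x" by blast
  qed
qed

section \<open>Choice of the eigenvalue\<close>

text \<open>
  The norms of the multiples of a vector shorter than \<open>hi - lo\<close> cannot jump over the interval from
  \<open>lo\<close> to \<open>hi\<close>.
\<close>

lemma multiple_with_norm_between:
  fixes A :: "(real^'d) set"
  assumes zero: "0 \<in> A" and add: "\<And>x y. x \<in> A \<Longrightarrow> y \<in> A \<Longrightarrow> x + y \<in> A"
    and small: "0 \<in> closure (A - {0})" and lohi: "0 < lo" "lo < hi"
  obtains a where "a \<in> A - {0}" "lo < norm a" "norm a < hi"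
proof -
  have "\<exists>b\<in>A - {0}. dist b 0 < hi - lo"
    using small lohi(2) unfolding closure_approachable by (meson diff_gt_0_iff_gt)
  then obtain b where b: "b \<in> A" "b \<noteq> 0" "norm b < hi - lo" by auto
  have mult: "real n *\<^sub>R b \<in> A" for n
    by (induction n) (use zero add b(1) in \<open>auto simp: algebra_simps\<close>)
  define n where "n = nat \<lfloor>lo / norm b\<rfloor> + 1"
  have n: "real n = of_int \<lfloor>lo / norm b\<rfloor> + 1"
    using lohi by (simp add: n_def)
  have "lo / norm b < real n" "real n \<le> lo / norm b + 1" unfolding n by linarith+
  then have "lo < real n * norm b" "real n * norm b \<le> lo + norm b"
    using b(2) by (simp_all add: field_simps)
  moreover have "real n *\<^sub>R b \<noteq> 0" using b(2) by (simp add: n_def)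
  ultimately show ?thesis using that[of "real n *\<^sub>R b"] mult b(3) by simp
qed

section \<open>Forbidden pairs of patches\<close>

text \<open>
  With \<open>c = \<chi>\<^sub>a(w)\<close> and \<open>d = \<chi>\<^sub>a(z)\<close>: if \<open>c\<close> is near \<open>1\<close>, then \<open>- c d\<close> is near \<open>- d\<close>, which lies in
  the closed left half plane and thus at distance at least \<open>1\<close> from \<open>1\<close>.
\<close>

lemma not_both_near_1:
  fixes c d :: complex
  assumes "cmod (c - 1) < 1 / 2" "cmod (- (c * d) - 1) < 1 / 2" "cmod d = 1" "Re d \<ge> 0"
  shows False
proof -
  have "1 \<le> Re (1 + d)" using assms(4) by simp
  also have "\<dots> \<le> cmod (1 + d)" by (rule complex_Re_le_cmod)
  also have "1 + d = - ((c - 1) * d) - (- (c * d) - 1)" by (simp add: algebra_simps)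
  also have "cmod \<dots> \<le> cmod ((c - 1) * d) + cmod (- (c * d) - 1)"
    using norm_triangle_ineq4[of "- ((c - 1) * d)"] by (simp only: norm_minus_cancel)
  also have "\<dots> < 1" using assms by (simp add: norm_mult)
  finally show False by simp
qed

theorem theorem3p5:
  fixes T \<A> :: "(real^'d) set set" and A :: "(real^'d) set" and R0 \<epsilon> :: real
  assumes "tiling T" and "repetitive T" and "FLC T" and "finite_tile_type T \<A>"
    and "subgroup A (eigenvalue_group T)"
    and "0 \<in> closure (A - {0})"
    and "R0 > 0" and "\<epsilon> > 0"
  shows "\<exists>R>0. \<exists>a\<in>A - {0}. \<exists>x :: (real^'d) set set \<Rightarrow> real^'d.
    (\<forall>P1 \<in> (\<Union>L\<in>{R<..}. Pi_patches T L \<A>). \<forall>P2 \<in> (\<Union>L\<in>{R<..}. Pi_patches T L \<A>).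
       \<forall>y\<in>Ker_chi a. \<forall>z\<in>ball 0 R0.
         \<not> legal T (translate P1 (x P1) \<union>
             translate P2 (x P2 + (1 / (2 * (norm a)\<^sup>2)) *\<^sub>R a + y + z))) \<and>
    8 * R0 < 1 / norm a \<and> 1 / norm a < (8 + \<epsilon>) * R0"
proof -
  have pT: "patch T" using assms(1) by (simp add: tiling_def)
  have A0: "0 \<in> A" using subgroup.one_closed[OF assms(5)] by (simp add: eigenvalue_group_def)
  have Aadd: "x + y \<in> A" if "x \<in> A" "y \<in> A" for x y
    using subgroup.m_closed[OF assms(5) that] by (simp add: eigenvalue_group_def)
  have lengths: "0 < 8 * R0" "8 * R0 < (8 + \<epsilon>) * R0" using assms(7,8) by simp_all
  then have pos: "0 < (8 + \<epsilon>) * R0" by (rule less_trans)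
  have interval: "0 < 1 / ((8 + \<epsilon>) * R0)" "1 / ((8 + \<epsilon>) * R0) < 1 / (8 * R0)"
    using pos lengths by (simp, intro divide_strict_left_mono mult_pos_pos) simp_all
  obtain a where a: "a \<in> A - {0}" "1 / ((8 + \<epsilon>) * R0) < norm a" "norm a < 1 / (8 * R0)"
    using multiple_with_norm_between[OF A0 Aadd assms(6) interval] by blast
  have a_pos: "norm a > 0" using a(1) by simp
  have norm_a: "8 * R0 < 1 / norm a" "1 / norm a < (8 + \<epsilon>) * R0"
    using less_imp_inverse_less[OF a(2)] less_imp_inverse_less[OF a(3) a_pos] pos
    by (simp_all only: inverse_eq_divide divide_divide_eq_right mult_1 div_by_1 zero_less_divide_1_iff)
  have eig: "topological_eigenvalue T a"
    using subgroup.subset[OF assms(5)] a(1) by (auto simp: eigenvalue_group_def)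
  obtain r where r: "r > 0"
      "\<And>u. translate (restr T (ball 0 r)) u \<subseteq> T \<Longrightarrow> cmod (chi a u - 1) < 1 / 2"
    using occurrence_of_central_patch_determines_character[OF assms(1,4) eig, of "1 / 2"] by auto
  define Q where "Q = restr T (ball 0 r)"
  have Q: "finite Q" "Q \<subseteq> T" "\<Union>Q \<subseteq> ball 0 r"
    unfolding Q_def using finite_restr_bounded[OF pT assms(4) bounded_ball]
    by (auto simp: restr_def)
  obtain R where R: "R > 0"
      "\<And>L v. L > R \<Longrightarrow> \<exists>x. Q \<subseteq> translate (restr (translate T (- v)) (ball 0 L)) x"
    using repetitive_large_patches_contain[OF assms(2) pT Q r(1)] by blast
  define x where "x P = (SOME x. Q \<subseteq> translate P x)" for P
  have x: "Q \<subseteq> translate P (x P)" if "P \<in> (\<Union>L\<in>{R<..}. Pi_patches T L \<A>)" for P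
  proof -
    have "\<exists>x. Q \<subseteq> translate P x" using that R(2) by (auto simp: Pi_patches_def)
    then show ?thesis unfolding x_def by (rule someI_ex)
  qed
  have occurs: "translate Q w \<subseteq> T" if "Q \<subseteq> P'" "translate P' w \<subseteq> T" for P' w
    using that unfolding translate_def by blast
  have "\<not> legal T (translate P1 (x P1) \<union>
             translate P2 (x P2 + (1 / (2 * (norm a)\<^sup>2)) *\<^sub>R a + y + z))"
    if P: "P1 \<in> (\<Union>L\<in>{R<..}. Pi_patches T L \<A>)" "P2 \<in> (\<Union>L\<in>{R<..}. Pi_patches T L \<A>)"
      and y: "y \<in> Ker_chi a" and z: "z \<in> ball 0 R0" for P1 P2 y z
  proof
    let ?h = "(1 / (2 * (norm a)\<^sup>2)) *\<^sub>R a"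
    assume "legal T (translate P1 (x P1) \<union> translate P2 (x P2 + ?h + y + z))"
    then obtain w where w: "translate (translate P1 (x P1)) w \<subseteq> T"
        "translate (translate P2 (x P2 + ?h + y + z)) w \<subseteq> T"
      unfolding legal_def by (auto simp: translate_def image_Un)
    have "translate (translate P2 (x P2)) (?h + y + z + w) \<subseteq> T"
      using w(2) by (simp add: translate_translate algebra_simps)
    then have "cmod (chi a (?h + y + z + w) - 1) < 1 / 2"
      by (intro r(2)[folded Q_def] occurs[OF x[OF P(2)]])
    moreover have "chi a (?h + y + z + w) = - (chi a w * chi a z)"
      using chi_half_period[of a] y a(1) by (simp add: chi_add Ker_chi_def)
    moreover have "cmod (chi a w - 1) < 1 / 2"
      by (intro r(2)[folded Q_def] occurs[OF x[OF P(1)] w(1)])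
    moreover have "Re (chi a z) \<ge> 0"
    proof (rule Re_chi_nonneg)
      have "\<bar>a \<bullet> z\<bar> \<le> norm a * norm z" by (rule Cauchy_Schwarz_ineq2)
      also have "\<dots> \<le> norm a * R0" using z by (simp add: mult_left_mono)
      also have "\<dots> \<le> 1 / 4" using norm_a(1) a_pos assms(7) by (simp add: field_simps)
      finally show "\<bar>a \<bullet> z\<bar> \<le> 1 / 4" .
    qed
    ultimately show False using not_both_near_1[of "chi a w" "chi a z"] by simp
  qed
  then show ?thesis using R(1) a(1) norm_a by blast
qed

end
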